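(* Let $f$ be an analytic function on $\mathbb{D}=\{z\in\mathbb{C}:|z|<1\}$ with $|f|<1$ and fix $z_0\in\mathbb{D}$. Then, for any point $z\in\mathbb{D}$ with $z\ne z_0$, $$\left|f'(z)-\frac{f(z)-f(z_0)}{z-z_0}\cdot\frac{1-\overline{f(z_0)}f(z)}{1-|f(z_0)|^2}\cdot\frac{1-|z_0|^2}{1-\overline{z_0}z}\right|$$ $$\le\frac{1}{1-|z|^2}\left(\frac{|1-\overline{f(z_0)}f(z)|^2}{1-|f(z_0)|^2}\cdot\left|\frac{z-z_0}{1-\overline{z_0}z}\right|-\frac{|f(z)-f(z_0)|^2}{1-|f(z_0)|^2}\cdot\left|\frac{1-\overline{z_0}z}{z-z_0}\right|\right),$$ where equality holds if and only if $f$ is a Blaschke product of degree at most $2$.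
   Context: A (finite) Blaschke product of degree $n$ is a function of the form $e^{i\theta}\prod_{j=1}^n\dfrac{z-a_j}{1-\overline{a_j}z}$ with $\theta\in\mathbb{R}$ and $a_1,\dots,a_n\in\mathbb{D}$. *)

theory Defs
  imports "HOL-Complex_Analysis.Complex_Analysis"
begin

(* Functions on the unit disc are total functions on the complex plane of which only
   the values on the open unit ball matter. For n = 0 the product is a unimodular constant. *)
definition blaschke_product :: "nat \<Rightarrow> (complex \<Rightarrow> complex) \<Rightarrow> bool" where
  "blaschke_product n f \<longleftrightarrow>
     (\<exists>(\<theta>::real) (a::nat \<Rightarrow> complex).
        (\<forall>j\<in>{1..n}. a j \<in> ball 0 1) \<and>
        (\<forall>z\<in>ball 0 1. f z = exp (\<i> * of_real \<theta>) * (\<Prod>j=1..n. (z - a j) / (1 - cnj (a j) * z))))"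

end

theory Submission
  imports Defs
begin

text \<open>
  Write \<open>b\<^sub>a(z) = (z - a) / (1 - cnj a * z)\<close> and \<open>w = f(z\<^sub>0)\<close>. The function \<open>b\<^sub>w \<circ> f\<close> maps the
  disc to itself and vanishes at \<open>z\<^sub>0\<close>, so by the Schwarz lemma it equals \<open>b\<close> times \<open>g\<close>, where
  \<open>b\<close> is the factor with zero \<open>z\<^sub>0\<close> and \<open>g\<close> is holomorphic with \<open>|g| \<le> 1\<close>
  (lemma \<open>hyperbolic_difference_quotient\<close>). Differentiating this factorization turns the
  left-hand side of the claim into \<open>K |b(z)| |g'(z)|\<close> and the right-hand side into
  \<open>K |b(z)| (1 - |g(z)|^2) / (1 - |z|^2)\<close>, with the same positive factor
  \<open>K = |1 - cnj w * f(z)|^2 / (1 - |w|^2)\<close>. The inequality is therefore the Schwarz-Pick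
  inequality for \<open>g\<close> at \<open>z\<close>, and equality means that \<open>g\<close> is a Blaschke product of degree at
  most 1 (lemma \<open>Schwarz_Pick\<close>).

  It remains to see that \<open>g\<close> has degree at most 1 if and only if \<open>f\<close> has degree at most 2.
  Up to the factor \<open>b\<close> this says that composing with a disc automorphism preserves Blaschke
  products of degree at most 2, and moreover that any zero of the composite in the disc can be
  split off as one of the two factors. This is an explicit computation with quadratic polynomials
  (lemma \<open>blaschke_factor_compose_at_zero\<close>).

  Lower degrees need no separate treatment once the zero \<open>a\<close> of a factor is allowed to lie on
  the unit circle: there \<open>b\<^sub>a\<close> is the unimodular constant \<open>- a\<close>, and in particular it is 1 for
  \<open>a = - 1\<close>. So degree at most 2 means two factors with zeros in the closed disc.
\<close>

section \<open>Blaschke factors with zero in the closed disc\<close>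

definition blaschke_factor :: "complex \<Rightarrow> complex \<Rightarrow> complex" where
  "blaschke_factor a z = (z - a) / (1 - cnj a * z)"

lemma blaschke_denominator_nonzero:
  assumes "cmod a \<le> 1" "cmod z < 1"
  shows "1 - cnj a * z \<noteq> 0"
proof
  assume "1 - cnj a * z = 0"
  then have "cmod a * cmod z = 1"
    by (metis complex_mod_cnj norm_mult norm_one right_minus_eq)
  moreover have "cmod a * cmod z \<le> 1 * cmod z"
    using assms by (intro mult_right_mono) auto
  ultimately show False using assms by linarith
qed

lemma one_minus_norm_blaschke_factor_sq:
  assumes "1 - cnj a * z \<noteq> 0"
  shows "1 - (cmod (blaschke_factor a z))\<^sup>2
       = (1 - (cmod a)\<^sup>2) * (1 - (cmod z)\<^sup>2) / (cmod (1 - cnj a * z))\<^sup>2"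
proof -
  have "(cmod (1 - cnj a * z))\<^sup>2 - (cmod (z - a))\<^sup>2 = (1 - (cmod a)\<^sup>2) * (1 - (cmod z)\<^sup>2)"
    unfolding cmod_power2 by (simp add: algebra_simps power2_eq_square)
  moreover have "(cmod (1 - cnj a * z))\<^sup>2 \<noteq> 0" using assms by simp
  ultimately show ?thesis
    unfolding blaschke_factor_def norm_divide power_divide
    by (simp add: field_simps)
qed

lemma norm_blaschke_factor_le_1:
  assumes "cmod a \<le> 1" "cmod z < 1"
  shows "cmod (blaschke_factor a z) \<le> 1"
proof -
  have "0 \<le> 1 - (cmod (blaschke_factor a z))\<^sup>2"
    unfolding one_minus_norm_blaschke_factor_sq[OF blaschke_denominator_nonzero[OF assms]]
    using assms by (intro divide_nonneg_nonneg mult_nonneg_nonneg) (auto simp: power_le_one)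
  then show ?thesis by (simp add: power2_le_iff_abs_le abs_square_le_1)
qed

lemma norm_blaschke_factor_less_1:
  assumes "cmod a < 1" "cmod z < 1"
  shows "cmod (blaschke_factor a z) < 1"
  using Moebius_function_norm_lt_1[OF assms, of 0]
  by (simp add: Moebius_function_simple blaschke_factor_def)

lemma DERIV_blaschke_factor:
  assumes "1 - cnj a * z \<noteq> 0"
  shows "(blaschke_factor a has_field_derivative
           of_real (1 - (cmod a)\<^sup>2) / (1 - cnj a * z)\<^sup>2) (at z)"
proof -
  have "((\<lambda>z. (z - a) / (1 - cnj a * z)) has_field_derivative
           (1 * (1 - cnj a * z) - (z - a) * (- cnj a)) / ((1 - cnj a * z) * (1 - cnj a * z))) (at z)"
    using assms by (intro DERIV_divide) (auto intro!: derivative_eq_intros)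
  moreover have "1 * (1 - cnj a * z) - (z - a) * (- cnj a) = of_real (1 - (cmod a)\<^sup>2)"
    by (simp add: complex_norm_square algebra_simps del: of_real_power)
  ultimately show ?thesis
    unfolding blaschke_factor_def[abs_def] power2_eq_square[of "1 - cnj a * z"] by metis
qed

lemma blaschke_factor_holomorphic:
  assumes "cmod a \<le> 1"
  shows "blaschke_factor a holomorphic_on ball 0 1"
  unfolding blaschke_factor_def[abs_def]
  using blaschke_denominator_nonzero[OF assms] by (intro holomorphic_intros) auto

lemma blaschke_factor_inverse:
  assumes "cmod a < 1" "cmod z < 1"
  shows "blaschke_factor (- a) (blaschke_factor a z) = z"
  using Moebius_function_compose[of "- a" a z] assms
  by (simp add: Moebius_function_simple blaschke_factor_def)

lemma blaschke_factor_unimodular: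
  assumes "cmod a = 1" "cmod z < 1"
  shows "blaschke_factor a z = - a"
proof -
  have "a * cnj a = 1" using complex_norm_square[of a] assms(1) by simp
  then have "z - a = - a * (1 - cnj a * z)" by (simp add: algebra_simps)
  then show ?thesis
    using blaschke_denominator_nonzero[of a z] assms by (simp add: blaschke_factor_def)
qed

lemma blaschke_factor_minus_one: "cmod z < 1 \<Longrightarrow> blaschke_factor (- 1) z = 1"
  using blaschke_factor_unimodular[of "- 1" z] by simp

section \<open>Blaschke products of degree at most two\<close>

text \<open>
  The zeros range over the closed disc, which makes room for the degrees 0 and 1 and, unlike the
  open disc, is what the root argument below yields directly.
\<close>

definition blaschke_degree_le_2 :: "(complex \<Rightarrow> complex) \<Rightarrow> bool" where
  "blaschke_degree_le_2 f \<longleftrightarrow> (\<exists>u a c. cmod u = 1 \<and> cmod a \<le> 1 \<and> cmod c \<le> 1 \<and>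
     (\<forall>z\<in>ball 0 1. f z = u * blaschke_factor a z * blaschke_factor c z))"

lemma blaschke_degree_le_2_iff: "blaschke_degree_le_2 f \<longleftrightarrow> (\<exists>n\<le>2. blaschke_product n f)"
proof
  assume "\<exists>n\<le>2. blaschke_product n f"
  then obtain n :: nat and \<theta> :: real and a where n: "n \<le> 2"
    and a_ball: "\<forall>j\<in>{1..n}. a j \<in> ball 0 1"
    and f_ball: "\<forall>z\<in>ball 0 1. f z =
          exp (\<i> * of_real \<theta>) * (\<Prod>j=1..n. blaschke_factor (a j) z)"
    unfolding blaschke_product_def blaschke_factor_def by blast
  have a: "cmod (a j) < 1" if "j \<in> {1..n}" for j using a_ball that by simp
  have f: "f z = exp (\<i> * of_real \<theta>) * (\<Prod>j=1..n. blaschke_factor (a j) z)"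
    if "cmod z < 1" for z using f_ball that by simp
  \<comment> \<open>Padding with the zero \<open>- 1\<close> adds factors equal to 1.\<close>
  define b where "b j = (if j \<le> n then a j else - 1)" for j
  have "f z = exp (\<i> * of_real \<theta>) * blaschke_factor (b 1) z * blaschke_factor (b 2) z"
    if "cmod z < 1" for z
  proof -
    have "{1..2} = {1..n} \<union> {Suc n..2}" using n by auto
    then have "(\<Prod>j=1..2. blaschke_factor (b j) z)
        = (\<Prod>j=1..n. blaschke_factor (b j) z) * (\<Prod>j=Suc n..2. blaschke_factor (b j) z)"
      by (simp add: prod.union_disjoint)
    also have "(\<Prod>j=1..n. blaschke_factor (b j) z) = (\<Prod>j=1..n. blaschke_factor (a j) z)"
      by (intro prod.cong) (auto simp: b_def)
    also have "(\<Prod>j=Suc n..2. blaschke_factor (b j) z) = 1"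
      using blaschke_factor_minus_one[OF that] by (intro prod.neutral) (auto simp: b_def)
    finally show ?thesis using f[OF that] by (simp add: numeral_2_eq_2)
  qed
  moreover have "cmod (b j) \<le> 1" if "1 \<le> j" for j using a[of j] that by (auto simp: b_def)
  ultimately show "blaschke_degree_le_2 f"
    unfolding blaschke_degree_le_2_def
    by (intro exI[of _ "exp (\<i> * of_real \<theta>)"] exI[of _ "b 1"] exI[of _ "b 2"]) auto
next
  have unimodular: "\<exists>\<theta>::real. exp (\<i> * of_real \<theta>) = u" if "cmod u = 1" for u
    using complex_unimodular_polar[OF that] by (metis cis_conv_exp cis.code)
  \<comment> \<open>What is left once a factor with unimodular zero has been absorbed into the constant.\<close>
  have deg1: "\<exists>n\<le>2. blaschke_product n f"
    if u: "cmod u = 1" and c: "cmod c \<le> 1"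
      and f: "\<forall>z\<in>ball 0 1. f z = u * blaschke_factor c z" for u c
  proof (cases "cmod c = 1")
    case True
    obtain \<theta> :: real where \<theta>: "exp (\<i> * of_real \<theta>) = u * (- c)"
      using unimodular[of "u * (- c)"] True u by (auto simp: norm_mult)
    have "blaschke_product 0 f"
      unfolding blaschke_product_def
      by (rule exI[of _ \<theta>]) (use f True \<theta> in \<open>auto simp: blaschke_factor_unimodular\<close>)
    then show ?thesis by blast
  next
    case False
    obtain \<theta> :: real where \<theta>: "exp (\<i> * of_real \<theta>) = u" using unimodular[OF u] by auto
    have "blaschke_product 1 f"
      unfolding blaschke_product_def
      by (rule exI[of _ \<theta>], rule exI[of _ "\<lambda>_. c"])
         (use f False c \<theta> in \<open>auto simp: blaschke_factor_def\<close>)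
    then show ?thesis by (meson one_le_numeral)
  qed
  assume "blaschke_degree_le_2 f"
  then obtain u a c where u: "cmod u = 1" and a: "cmod a \<le> 1" and c: "cmod c \<le> 1"
    and f: "\<forall>z\<in>ball 0 1. f z = u * blaschke_factor a z * blaschke_factor c z"
    unfolding blaschke_degree_le_2_def by blast
  consider "cmod a = 1" | "cmod c = 1" | "cmod a < 1" "cmod c < 1" using a c by linarith
  then show "\<exists>n\<le>2. blaschke_product n f"
  proof cases
    case 1
    then show ?thesis
      using deg1[of "u * (- a)" c] u c f by (auto simp: blaschke_factor_unimodular norm_mult)
  next
    case 2
    then show ?thesis
      using deg1[of "u * (- c)" a] u a f
      by (auto simp: blaschke_factor_unimodular norm_mult mult_ac)
  next
    case 3
    obtain \<theta> :: real where \<theta>: "exp (\<i> * of_real \<theta>) = u" using unimodular[OF u] by auto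
    have "blaschke_product 2 f"
      unfolding blaschke_product_def
      by (rule exI[of _ \<theta>], rule exI[of _ "\<lambda>j. if j = 1 then a else c"])
         (use f 3 \<theta> in \<open>auto simp: blaschke_factor_def numeral_2_eq_2\<close>)
    then show ?thesis by blast
  qed
qed

text \<open>
  The number below is the coefficient of \<open>z^2\<close> in the numerator of \<open>b\<^sub>w (u b\<^sub>a(z) b\<^sub>c(z))\<close>, so that
  this numerator really has two roots.
\<close>

lemma leading_coefficient_nonzero:
  assumes "cmod u = 1" "cmod a \<le> 1" "cmod c \<le> 1" "cmod w < 1"
  shows "u - w * cnj a * cnj c \<noteq> 0"
proof -
  have "cmod w * (cmod a * cmod c) \<le> cmod w * 1"
    using assms by (intro mult_left_mono mult_le_one) auto
  then have "cmod (w * cnj a * cnj c) < 1" using assms by (simp add: norm_mult)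
  then show ?thesis using assms by auto
qed

text \<open>
  With the common denominator cleared, \<open>b\<^sub>w (u b\<^sub>a b\<^sub>c)\<close> becomes \<open>N / D\<close> for two quadratics.
  Because \<open>|u| = 1\<close>, \<open>D\<close> is up to the factor \<open>u\<close> the reflection \<open>z^2 cnj (N (1 / cnj z))\<close> of \<open>N\<close>.
  So if \<open>N\<close> has the roots \<open>p\<close> and \<open>q\<close>, then \<open>D\<close> is a constant times
  \<open>(1 - cnj p * z) (1 - cnj q * z)\<close>, and \<open>N / D\<close> is a unimodular constant times \<open>b\<^sub>p b\<^sub>q\<close>. A root
  outside the closed disc would reflect to a zero of \<open>D\<close> inside the disc, which is impossible
  since \<open>|u b\<^sub>a b\<^sub>c| \<le> 1\<close> and \<open>|w| < 1\<close>. The last hypothesis is \<open>N(p) = 0\<close>; keeping the root \<open>p\<close>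
  at choice allows a known zero to be divided out afterwards.
\<close>

lemma blaschke_factor_compose_at_zero:
  assumes u: "cmod u = 1" and a: "cmod a \<le> 1" and c: "cmod c \<le> 1" and w: "cmod w < 1"
    and p: "u * (p - a) * (p - c) = w * (1 - cnj a * p) * (1 - cnj c * p)"
  obtains v q where "cmod v = 1" "cmod p \<le> 1" "cmod q \<le> 1"
    "\<And>z. cmod z < 1 \<Longrightarrow> blaschke_factor w (u * blaschke_factor a z * blaschke_factor c z)
                        = v * blaschke_factor p z * blaschke_factor q z"
proof -
  define A where "A = u - w * cnj a * cnj c"
  define B where "B = w * (cnj a + cnj c) - u * (a + c)"
  \<comment> \<open>The other root, by Vieta.\<close>
  define q where "q = - B / A - p"
  define N where "N z = u * (z - a) * (z - c) - w * (1 - cnj a * z) * (1 - cnj c * z)" for z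
  define D where "D z = (1 - cnj a * z) * (1 - cnj c * z) - cnj w * u * (z - a) * (z - c)" for z
  have uu: "u * cnj u = 1" using complex_norm_square[of u] u by simp
  have A0: "A \<noteq> 0" unfolding A_def by (rule leading_coefficient_nonzero[OF u a c w])
  have Bq: "B = - A * (p + q)" using A0 by (simp add: q_def field_simps)
  have N_expand: "N z = A * z\<^sup>2 + B * z + (u * a * c - w)" for z
    by (simp add: N_def A_def B_def algebra_simps power2_eq_square)
  have "N p = 0" using p by (simp add: N_def)
  then have C: "u * a * c - w = A * p * q"
    unfolding N_expand Bq by (simp add: algebra_simps power2_eq_square)
  have N_factor: "N z = A * (z - p) * (z - q)" for z
    unfolding N_expand C Bq by (simp add: algebra_simps power2_eq_square)
  have D_expand: "D z = u * (cnj (u * a * c - w) * z\<^sup>2 + cnj B * z + cnj A)" for z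
  proof -
    have "u * (cnj (u * a * c - w) * z\<^sup>2 + cnj B * z + cnj A)
        = (u * cnj u) * (cnj a * cnj c * z\<^sup>2 - (cnj a + cnj c) * z + 1)
           + u * (- cnj w * z\<^sup>2 + cnj w * (a + c) * z - cnj w * a * c)"
      by (simp add: A_def B_def algebra_simps)
    also have "\<dots> = D z" unfolding uu by (simp add: D_def algebra_simps power2_eq_square)
    finally show ?thesis by simp
  qed
  have D_factor: "D z = u * cnj A * (1 - cnj p * z) * (1 - cnj q * z)" for z
    unfolding D_expand C Bq by (simp add: algebra_simps power2_eq_square)
  have D0: "D z \<noteq> 0" if z: "cmod z < 1" for z
  proof -
    let ?s = "u * blaschke_factor a z * blaschke_factor c z"
    have da: "1 - cnj a * z \<noteq> 0" and dc: "1 - cnj c * z \<noteq> 0"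
      using blaschke_denominator_nonzero a c z by auto
    have "cmod ?s \<le> 1"
      using norm_blaschke_factor_le_1[OF a z] norm_blaschke_factor_le_1[OF c z] u
      by (simp add: norm_mult mult_le_one)
    then have "1 - cnj ?s * w \<noteq> 0" using w by (rule blaschke_denominator_nonzero)
    then have "1 - cnj w * ?s \<noteq> 0"
      by (metis complex_cnj_cnj complex_cnj_diff complex_cnj_mult complex_cnj_one
          complex_cnj_zero mult.commute)
    moreover have "D z = (1 - cnj a * z) * (1 - cnj c * z) * (1 - cnj w * ?s)"
    proof -
      have "(1 - cnj a * z) * blaschke_factor a z = z - a"
        and "(1 - cnj c * z) * blaschke_factor c z = z - c"
        using da dc by (simp_all add: blaschke_factor_def)
      then show ?thesis unfolding D_def by algebra
    qed
    ultimately show ?thesis using da dc by simp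
  qed
  have le1: "cmod r \<le> 1" if r: "r = p \<or> r = q" for r
  proof (rule ccontr)
    assume "\<not> cmod r \<le> 1"
    then have "cmod (1 / cnj r) < 1" "cnj r \<noteq> 0" 
      by (auto simp: norm_divide divide_less_eq)
    then show False using D0[of "1 / cnj r"] r by (auto simp: D_factor)
  qed
  show ?thesis
  proof (rule that)
    show "cmod (A / (u * cnj A)) = 1" using A0 u by (simp add: norm_divide norm_mult)
    show "cmod p \<le> 1" "cmod q \<le> 1" using le1 by auto
    fix z :: complex assume z: "cmod z < 1"
    have da: "1 - cnj a * z \<noteq> 0" and dc: "1 - cnj c * z \<noteq> 0"
      using blaschke_denominator_nonzero a c z by auto
    let ?P = "(1 - cnj a * z) * (1 - cnj c * z)"
    let ?s = "u * blaschke_factor a z * blaschke_factor c z"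
    have s: "?s = u * (z - a) * (z - c) / ?P" by (simp add: blaschke_factor_def)
    have "?s - w = N z / ?P" "1 - cnj w * ?s = D z / ?P"
      unfolding s N_def D_def using da dc by (simp_all add: diff_divide_distrib mult.assoc)
    then have "blaschke_factor w ?s = N z / D z"
      unfolding blaschke_factor_def[of w] using da dc by simp
    also have "\<dots> = A / (u * cnj A) * blaschke_factor p z * blaschke_factor q z"
      by (simp add: N_factor D_factor blaschke_factor_def)
    finally show "blaschke_factor w ?s = A / (u * cnj A) * blaschke_factor p z * blaschke_factor q z" .
  qed
qed

text \<open>A root \<open>p\<close> of the numerator comes from the quadratic formula.\<close>

lemma blaschke_degree_le_2_compose:
  assumes f: "blaschke_degree_le_2 f" and w: "cmod w < 1"
  shows "blaschke_degree_le_2 (\<lambda>z. blaschke_factor w (f z))"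
proof -
  obtain u a c where u: "cmod u = 1" and a: "cmod a \<le> 1" and c: "cmod c \<le> 1"
    and f: "\<forall>z\<in>ball 0 1. f z = u * blaschke_factor a z * blaschke_factor c z"
    using f unfolding blaschke_degree_le_2_def by blast
  define A where "A = u - w * cnj a * cnj c"
  define B where "B = w * (cnj a + cnj c) - u * (a + c)"
  define C where "C = u * a * c - w"
  have A0: "A \<noteq> 0" unfolding A_def by (rule leading_coefficient_nonzero[OF u a c w])
  define p where "p = (csqrt (B\<^sup>2 - 4 * A * C) - B) / (2 * A)"
  have "(2 * A * p + B)\<^sup>2 = B\<^sup>2 - 4 * A * C" using A0 by (simp add: p_def)
  then have "4 * A * (A * p\<^sup>2 + B * p + C) = 0" by (simp add: algebra_simps power2_eq_square)
  then have "A * p\<^sup>2 + B * p + C = 0" using A0 by simp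
  then have "u * (p - a) * (p - c) = w * (1 - cnj a * p) * (1 - cnj c * p)"
    by (simp add: A_def B_def C_def algebra_simps power2_eq_square)
  from blaschke_factor_compose_at_zero[OF u a c w this] f show ?thesis
    unfolding blaschke_degree_le_2_def by (metis mem_ball_0)
qed

section \<open>The Schwarz lemma and the Schwarz-Pick inequality\<close>

lemma unimodular_constant_if_norm_attains_1:
  assumes g: "g holomorphic_on ball 0 1" and le: "\<And>z. cmod z < 1 \<Longrightarrow> cmod (g z) \<le> 1"
    and z: "cmod z < 1" and eq: "cmod (g z) = 1"
  shows "\<forall>x\<in>ball 0 1. g x = g z"
proof -
  have "g constant_on ball 0 1"
    by (rule maximum_modulus_principle[OF g, where U = "ball 0 1" and \<xi> = z]) (use le z eq in auto)
  then show ?thesis using z unfolding constant_on_def by (metis mem_ball_0)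
qed

text \<open>
  The Schwarz lemma with an arbitrary zero \<open>a\<close>: the automorphism \<open>b\<^sub>a\<close> moves \<open>a\<close> to the origin.
\<close>

lemma Schwarz_divide_blaschke_factor:
  assumes F: "F holomorphic_on ball 0 1" and lt: "\<And>z. cmod z < 1 \<Longrightarrow> cmod (F z) < 1"
    and a: "cmod a < 1" and zero: "F a = 0"
  obtains g where "g holomorphic_on ball 0 1" "\<And>z. cmod z < 1 \<Longrightarrow> cmod (g z) \<le> 1"
    "\<And>z. cmod z < 1 \<Longrightarrow> F z = blaschke_factor a z * g z"
proof -
  define h where "h = F \<circ> blaschke_factor (- a)"
  have h: "h holomorphic_on ball 0 1" unfolding h_def
    by (rule holomorphic_on_compose_gen[OF blaschke_factor_holomorphic F])
       (use a norm_blaschke_factor_less_1[of "- a"] in auto)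
  have h0: "h 0 = 0" using zero by (simp add: h_def blaschke_factor_def)
  have hlt: "cmod (h z) < 1" if "cmod z < 1" for z
    using lt norm_blaschke_factor_less_1[of "- a" z] a that by (simp add: h_def)
  obtain k where k: "k holomorphic_on ball 0 1" and hk: "\<And>z. cmod z < 1 \<Longrightarrow> h z = z * k z"
    and dk: "deriv h 0 = k 0"
    using Schwarz3[OF h h0] by metis
  have kle: "cmod (k z) \<le> 1" if z: "cmod z < 1" for z
  proof (cases "z = 0")
    case True
    then show ?thesis using Schwarz_Lemma(2)[OF h h0 hlt z] dk by simp
  next
    case False
    then show ?thesis using Schwarz_Lemma(1)[OF h h0 hlt z] hk[OF z] by (simp add: norm_mult)
  qed
  show ?thesis
  proof (rule that)
    show "(k \<circ> blaschke_factor a) holomorphic_on ball 0 1"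
      by (rule holomorphic_on_compose_gen[OF blaschke_factor_holomorphic k])
         (use a norm_blaschke_factor_less_1 in auto)
    fix z :: complex assume z: "cmod z < 1"
    have m: "cmod (blaschke_factor a z) < 1" using a z by (rule norm_blaschke_factor_less_1)
    show "cmod ((k \<circ> blaschke_factor a) z) \<le> 1" using kle[OF m] by simp
    show "F z = blaschke_factor a z * (k \<circ> blaschke_factor a) z"
      using hk[OF m] blaschke_factor_inverse[OF a z] by (simp add: h_def)
  qed
qed

text \<open>
  The function \<open>g\<close> is the analogue of the difference quotient of \<open>f\<close> at \<open>a\<close> for the
  pseudohyperbolic distance. The last identity is the derivative of the factorization, with the
  chain rule on the left and the product rule on the right. It is used twice: at the base point
  \<open>x = a\<close> it gives the Schwarz-Pick inequality, and away from it the theorem.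
\<close>

lemma hyperbolic_difference_quotient:
  assumes f: "f holomorphic_on ball 0 1" and lt: "\<And>x. cmod x < 1 \<Longrightarrow> cmod (f x) < 1"
    and a: "cmod a < 1"
  obtains g where "g holomorphic_on ball 0 1" "\<And>x. cmod x < 1 \<Longrightarrow> cmod (g x) \<le> 1"
    "\<And>x. cmod x < 1 \<Longrightarrow> blaschke_factor (f a) (f x) = blaschke_factor a x * g x"
    "\<And>x. cmod x < 1 \<Longrightarrow>
       of_real (1 - (cmod (f a))\<^sup>2) / (1 - cnj (f a) * f x)\<^sup>2 * deriv f x
     = of_real (1 - (cmod a)\<^sup>2) / (1 - cnj a * x)\<^sup>2 * g x + deriv g x * blaschke_factor a x"
proof -
  define w where "w = f a"
  have w: "cmod w < 1" using lt[OF a] by (simp add: w_def)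
  have "(blaschke_factor w \<circ> f) holomorphic_on ball 0 1"
    by (rule holomorphic_on_compose_gen[OF f blaschke_factor_holomorphic]) (use w lt in auto)
  then obtain g where g: "g holomorphic_on ball 0 1" and gle: "\<And>x. cmod x < 1 \<Longrightarrow> cmod (g x) \<le> 1"
    and fg: "\<And>x. cmod x < 1 \<Longrightarrow> blaschke_factor w (f x) = blaschke_factor a x * g x"
    using Schwarz_divide_blaschke_factor[of "blaschke_factor w \<circ> f" a]
      norm_blaschke_factor_less_1[OF w lt] a
    by (auto simp: w_def blaschke_factor_def)
  have "of_real (1 - (cmod w)\<^sup>2) / (1 - cnj w * f x)\<^sup>2 * deriv f x
      = of_real (1 - (cmod a)\<^sup>2) / (1 - cnj a * x)\<^sup>2 * g x + deriv g x * blaschke_factor a x"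
    if x: "cmod x < 1" for x
  proof (rule DERIV_unique)
    have dw: "1 - cnj w * f x \<noteq> 0" and da: "1 - cnj a * x \<noteq> 0"
      using blaschke_denominator_nonzero w a x lt[OF x] by auto
    have df: "(f has_field_derivative deriv f x) (at x)"
      using holomorphic_derivI[OF f open_ball] x by simp
    have dg: "(g has_field_derivative deriv g x) (at x)"
      using holomorphic_derivI[OF g open_ball] x by simp
    show "((\<lambda>y. blaschke_factor w (f y)) has_field_derivative
        of_real (1 - (cmod w)\<^sup>2) / (1 - cnj w * f x)\<^sup>2 * deriv f x) (at x)"
      by (rule DERIV_chain2[OF DERIV_blaschke_factor[OF dw] df])
    have ev: "\<forall>\<^sub>F y in nhds x. blaschke_factor w (f y) = blaschke_factor a y * g y"
      by (rule eventually_mono[OF eventually_nhds_in_open[of "ball 0 1" x]])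
         (use fg x in auto)
    have "((\<lambda>y. blaschke_factor a y * g y) has_field_derivative
        of_real (1 - (cmod a)\<^sup>2) / (1 - cnj a * x)\<^sup>2 * g x
          + deriv g x * blaschke_factor a x) (at x)"
      by (intro DERIV_mult DERIV_blaschke_factor dg da)
    then show "((\<lambda>y. blaschke_factor w (f y)) has_field_derivative
        of_real (1 - (cmod a)\<^sup>2) / (1 - cnj a * x)\<^sup>2 * g x
          + deriv g x * blaschke_factor a x) (at x)"
      using DERIV_cong_ev[OF refl ev refl] by blast
  qed
  from that[OF g gle fg[unfolded w_def] this[unfolded w_def]] show ?thesis .
qed

text \<open>
  Let \<open>k\<close> be the hyperbolic difference quotient of \<open>g\<close> at \<open>z\<close>. At the point \<open>z\<close> itself the
  derivative identity reads \<open>g'(z) / (1 - |g(z)|^2) = k(z) / (1 - |z|^2)\<close>, so the inequality is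
  \<open>|k(z)| \<le> 1\<close>. In case of equality \<open>k\<close> attains its maximal modulus and is constant, and solving
  for \<open>g\<close> shows that it is a Blaschke factor. Unimodular constants \<open>g\<close>, for which both sides
  vanish, are included; they correspond to \<open>f\<close> of degree 1 in the theorem.
\<close>

lemma Schwarz_Pick:
  assumes g: "g holomorphic_on ball 0 1" and le: "\<And>z. cmod z < 1 \<Longrightarrow> cmod (g z) \<le> 1"
    and z: "cmod z < 1"
  shows "cmod (deriv g z) \<le> (1 - (cmod (g z))\<^sup>2) / (1 - (cmod z)\<^sup>2)"
    and "cmod (deriv g z) = (1 - (cmod (g z))\<^sup>2) / (1 - (cmod z)\<^sup>2) \<Longrightarrow>
         \<exists>v q. cmod v = 1 \<and> cmod q \<le> 1 \<and> (\<forall>x\<in>ball 0 1. g x = v * blaschke_factor q x)"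
proof -
  have "cmod (deriv g z) \<le> (1 - (cmod (g z))\<^sup>2) / (1 - (cmod z)\<^sup>2) \<and>
    (cmod (deriv g z) = (1 - (cmod (g z))\<^sup>2) / (1 - (cmod z)\<^sup>2) \<longrightarrow>
         (\<exists>v q. cmod v = 1 \<and> cmod q \<le> 1 \<and> (\<forall>x\<in>ball 0 1. g x = v * blaschke_factor q x)))"
  \<comment> \<open>If \<open>|g(z)| = 1\<close>, then \<open>b\<^sub>w\<close> with \<open>w = g(z)\<close> is not an automorphism, but \<open>g\<close> is constant.\<close>
  proof (cases "cmod (g z) = 1")
    case True
    have const: "\<forall>x\<in>ball 0 1. g x = g z"
      using unimodular_constant_if_norm_attains_1[OF g le z True] .
    have "\<forall>\<^sub>F x in nhds z. x \<in> ball 0 1"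
      using z by (intro eventually_nhds_in_open) auto
    then have "\<forall>\<^sub>F x in nhds z. g x = g z"
      by (rule eventually_mono) (rule bspec[OF const])
    then have "deriv g z = deriv (\<lambda>_. g z) z" by (rule deriv_cong_ev) simp
    then have "deriv g z = 0" by simp
    moreover have "\<forall>x\<in>ball 0 1. g x = g z * blaschke_factor (- 1) x"
      using const by (auto simp: blaschke_factor_minus_one)
    moreover have "cmod (- 1) \<le> 1" by simp
    ultimately show ?thesis using True by (metis diff_self div_0 norm_zero one_power2 order_refl)
  next
    case False
    have lt: "cmod (g x) < 1" if x: "cmod x < 1" for x
    proof (rule ccontr)
      assume "\<not> cmod (g x) < 1"
      then have gx: "cmod (g x) = 1" using le[OF x] by linarith
      have "g z = g x"
        using bspec[OF unimodular_constant_if_norm_attains_1[OF g le x gx], of z] z by simp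
      then show False using gx False by simp
    qed
    define w where "w = g z"
    have w: "cmod w < 1" using lt[OF z] by (simp add: w_def)
    obtain k where k: "k holomorphic_on ball 0 1" and kle: "\<And>x. cmod x < 1 \<Longrightarrow> cmod (k x) \<le> 1"
      and gk: "\<And>x. cmod x < 1 \<Longrightarrow> blaschke_factor w (g x) = blaschke_factor z x * k x"
      and dk: "\<And>x. cmod x < 1 \<Longrightarrow> of_real (1 - (cmod w)\<^sup>2) / (1 - cnj w * g x)\<^sup>2 * deriv g x
          = of_real (1 - (cmod z)\<^sup>2) / (1 - cnj z * x)\<^sup>2 * k x + deriv k x * blaschke_factor z x"
      using hyperbolic_difference_quotient[OF g lt z] unfolding w_def by blast
    have zp: "1 - (cmod z)\<^sup>2 > 0" and wp: "1 - (cmod w)\<^sup>2 > 0"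
      using z w by (simp_all add: abs_square_less_1)
    have self: "1 - cnj x * x = of_real (1 - (cmod x)\<^sup>2)" for x
      by (simp add: complex_norm_square mult.commute del: of_real_power)
    define W where "W = (of_real (1 - (cmod w)\<^sup>2) :: complex)"
    define Z where "Z = (of_real (1 - (cmod z)\<^sup>2) :: complex)"
    have WZ0: "W \<noteq> 0" "Z \<noteq> 0"
      using zp wp unfolding W_def Z_def of_real_eq_0_iff by linarith+
    have "W / W\<^sup>2 * deriv g z = Z / Z\<^sup>2 * k z"
      using dk[OF z] unfolding w_def[symmetric] self W_def Z_def by (simp add: blaschke_factor_def)
    then have "deriv g z / W = k z / Z" using WZ0 by (simp add: power2_eq_square)
    then have "cmod (deriv g z / of_real (1 - (cmod w)\<^sup>2)) = cmod (k z / of_real (1 - (cmod z)\<^sup>2))"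
      unfolding W_def Z_def by (rule arg_cong)
    then have eq: "cmod (deriv g z) = cmod (k z) * ((1 - (cmod w)\<^sup>2) / (1 - (cmod z)\<^sup>2))"
      using zp wp unfolding norm_divide norm_of_real by (simp add: field_simps)
    have "cmod (deriv g z) \<le> (1 - (cmod w)\<^sup>2) / (1 - (cmod z)\<^sup>2)"
      unfolding eq using kle[OF z] zp wp by (intro mult_left_le_one_le) auto
    moreover have "\<exists>v q. cmod v = 1 \<and> cmod q \<le> 1 \<and> (\<forall>x\<in>ball 0 1. g x = v * blaschke_factor q x)"
      if "cmod (deriv g z) = (1 - (cmod w)\<^sup>2) / (1 - (cmod z)\<^sup>2)"
    proof -
      have k1: "cmod (k z) = 1" using eq that zp wp by simp
      have g_eq: "g x = blaschke_factor (- w) (k z * blaschke_factor z x * blaschke_factor (- 1) x)"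
        if x: "cmod x < 1" for x
      proof -
        have "k x = k z"
          using bspec[OF unimodular_constant_if_norm_attains_1[OF k kle z k1], of x] x by simp
        then have "k z * blaschke_factor z x * blaschke_factor (- 1) x = blaschke_factor w (g x)"
          using gk[OF x] x by (simp add: blaschke_factor_minus_one)
        then show ?thesis using blaschke_factor_inverse[OF w lt[OF x]] by simp
      qed
      have z_le: "cmod z \<le> 1" and m1_le: "cmod (- 1) \<le> 1" and mw: "cmod (- w) < 1"
        using z w by simp_all
      \<comment> \<open>The dummy factor with zero \<open>- 1\<close> turns a composite of degree one into one of degree two.
        The numerator keeps the root \<open>- 1\<close>, so the dummy factor can be split off again.\<close>
      have root: "k z * (- 1 - z) * (- 1 - - 1) = - w * (1 - cnj z * - 1) * (1 - cnj (- 1) * - 1)"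
        by simp
      obtain v q where v: "cmod v = 1" and q: "cmod q \<le> 1"
        and vq: "\<And>x. cmod x < 1 \<Longrightarrow>
            blaschke_factor (- w) (k z * blaschke_factor z x * blaschke_factor (- 1) x)
              = v * blaschke_factor (- 1) x * blaschke_factor q x"
        by (rule blaschke_factor_compose_at_zero[OF k1 z_le m1_le mw root]) (rule that)
      then show ?thesis using g_eq by (auto simp: blaschke_factor_minus_one)
    qed
    ultimately show ?thesis by (auto simp: w_def)
  qed
  then show "cmod (deriv g z) \<le> (1 - (cmod (g z))\<^sup>2) / (1 - (cmod z)\<^sup>2)"
    and "cmod (deriv g z) = (1 - (cmod (g z))\<^sup>2) / (1 - (cmod z)\<^sup>2) \<Longrightarrow>
         \<exists>v q. cmod v = 1 \<and> cmod q \<le> 1 \<and> (\<forall>x\<in>ball 0 1. g x = v * blaschke_factor q x)"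
    by blast+
qed

text \<open>
  For the converse it is enough to know \<open>g\<close> near \<open>z\<close>. In the theorem \<open>g = v b\<^sub>q\<close> results from a
  division by \<open>b\<close>, hence only away from the zero of \<open>b\<close>.
\<close>

lemma Schwarz_Pick_equality:
  assumes v: "cmod v = 1" and q: "cmod q \<le> 1" and z: "cmod z < 1"
    and g: "eventually (\<lambda>x. g x = v * blaschke_factor q x) (nhds z)"
  shows "cmod (deriv g z) = (1 - (cmod (g z))\<^sup>2) / (1 - (cmod z)\<^sup>2)"
proof -
  have nz: "1 - cnj q * z \<noteq> 0" using q z by (rule blaschke_denominator_nonzero)
  have "deriv g z = deriv (\<lambda>x. v * blaschke_factor q x) z" by (rule deriv_cong_ev[OF g refl])
  also have "\<dots> = v * (of_real (1 - (cmod q)\<^sup>2) / (1 - cnj q * z)\<^sup>2)"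
    by (intro DERIV_imp_deriv DERIV_cmult DERIV_blaschke_factor nz)
  finally have "cmod (deriv g z) = \<bar>1 - (cmod q)\<^sup>2\<bar> / (cmod (1 - cnj q * z))\<^sup>2"
    using v by (simp only: norm_mult norm_divide norm_power norm_of_real mult_1_left)
  moreover have "(cmod q)\<^sup>2 \<le> 1" using q by (simp add: power_le_one)
  moreover have "1 - (cmod z)\<^sup>2 \<noteq> 0" using z abs_square_less_1[of "cmod z"] by simp
  moreover have "cmod (g z) = cmod (blaschke_factor q z)"
    using eventually_nhds_x_imp_x[OF g] v by (simp add: norm_mult)
  ultimately show ?thesis
    using one_minus_norm_blaschke_factor_sq[OF nz] by simp
qed

section \<open>The inequality and its equality case\<close>

theorem theorem3p6:
  fixes f :: "complex \<Rightarrow> complex" and z0 :: complex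
  assumes "f analytic_on ball 0 1"
    and "\<And>w. w \<in> ball 0 1 \<Longrightarrow> cmod (f w) < 1"
    and "z0 \<in> ball 0 1"
  defines "L \<equiv> \<lambda>z. cmod (deriv f z - (f z - f z0) / (z - z0)
                 * ((1 - cnj (f z0) * f z) / of_real (1 - (cmod (f z0))\<^sup>2))
                 * (of_real (1 - (cmod z0)\<^sup>2) / (1 - cnj z0 * z)))"
    and "R \<equiv> \<lambda>z. 1 / (1 - (cmod z)\<^sup>2)
                 * ((cmod (1 - cnj (f z0) * f z))\<^sup>2 / (1 - (cmod (f z0))\<^sup>2)
                      * cmod ((z - z0) / (1 - cnj z0 * z))
                    - (cmod (f z - f z0))\<^sup>2 / (1 - (cmod (f z0))\<^sup>2)
                      * cmod ((1 - cnj z0 * z) / (z - z0)))"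
  shows "\<forall>z\<in>ball 0 1. z \<noteq> z0 \<longrightarrow>
           L z \<le> R z \<and> (L z = R z \<longleftrightarrow> (\<exists>n\<le>2. blaschke_product n f))"
proof (intro ballI impI)
  fix z :: complex assume "z \<in> ball 0 1" and ne: "z \<noteq> z0"
  then have z: "cmod z < 1" by simp
  have z0: "cmod z0 < 1" using assms(3) by simp
  have f: "f holomorphic_on ball 0 1" using assms(1) by (simp add: analytic_on_open)
  have flt: "cmod (f x) < 1" if "cmod x < 1" for x using assms(2) that by simp
  define w where "w = f z0"
  have w: "cmod w < 1" using flt[OF z0] by (simp add: w_def)
  obtain g where g: "g holomorphic_on ball 0 1" and gle: "\<And>x. cmod x < 1 \<Longrightarrow> cmod (g x) \<le> 1"
    and fg: "\<And>x. cmod x < 1 \<Longrightarrow> blaschke_factor w (f x) = blaschke_factor z0 x * g x"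
    and dfg: "\<And>x. cmod x < 1 \<Longrightarrow> of_real (1 - (cmod w)\<^sup>2) / (1 - cnj w * f x)\<^sup>2 * deriv f x
        = of_real (1 - (cmod z0)\<^sup>2) / (1 - cnj z0 * x)\<^sup>2 * g x + deriv g x * blaschke_factor z0 x"
    using hyperbolic_difference_quotient[OF f flt z0] unfolding w_def by blast
  define m where "m = blaschke_factor z0 z"
  define K where "K = (cmod (1 - cnj w * f z))\<^sup>2 / (1 - (cmod w)\<^sup>2)"
  have dw: "1 - cnj w * f z \<noteq> 0" and d0: "1 - cnj z0 * z \<noteq> 0"
    using blaschke_denominator_nonzero w z0 z flt[OF z] by auto
  have zp: "1 - (cmod z)\<^sup>2 > 0" and wp: "1 - (cmod w)\<^sup>2 > 0"
    using z w by (simp_all add: abs_square_less_1)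
  have m0: "m \<noteq> 0" using ne d0 by (simp add: m_def blaschke_factor_def)
  have K0: "K > 0" using dw wp by (simp add: K_def)
  have fgz: "(f z - w) / (1 - cnj w * f z) = m * g z"
    using fg[OF z] by (simp add: m_def blaschke_factor_def)
  then have fw: "f z - w = m * g z * (1 - cnj w * f z)" using dw by (simp add: field_simps)

  have L: "L z = K * cmod m * cmod (deriv g z)"
  proof -
    define W where "W = (of_real (1 - (cmod w)\<^sup>2) :: complex)"
    define Z where "Z = (of_real (1 - (cmod z0)\<^sup>2) :: complex)"
    define P where "P = 1 - cnj w * f z"
    define Q where "Q = 1 - cnj z0 * z"
    have W0: "W \<noteq> 0" using wp unfolding W_def of_real_eq_0_iff by linarith
    have P0: "P \<noteq> 0" and Q0: "Q \<noteq> 0" using dw d0 by (simp_all add: P_def Q_def)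
    have "W / P\<^sup>2 * deriv f z = Z / Q\<^sup>2 * g z + deriv g z * m"
      using dfg[OF z] unfolding m_def W_def Z_def P_def Q_def .
    then have "deriv f z = P\<^sup>2 / W * (Z / Q\<^sup>2 * g z + deriv g z * m)"
      using W0 P0 by (simp add: field_simps)
    moreover have "(f z - w) / (z - z0) = g z * P / Q"
      using fw ne Q0 by (simp add: m_def blaschke_factor_def P_def Q_def field_simps)
    ultimately have "deriv f z - (f z - w) / (z - z0) * (P / W) * (Z / Q) = P\<^sup>2 / W * (deriv g z * m)"
      by (simp add: algebra_simps power2_eq_square)
    moreover have "cmod W = 1 - (cmod w)\<^sup>2" unfolding W_def norm_of_real using wp by simp
    ultimately show ?thesis
      unfolding L_def w_def[symmetric] K_def
      unfolding W_def[symmetric] Z_def[symmetric] P_def[symmetric] Q_def[symmetric]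
      by (simp add: norm_mult norm_divide norm_power)
  qed
  have R: "R z = K * cmod m * ((1 - (cmod (g z))\<^sup>2) / (1 - (cmod z)\<^sup>2))"
  proof -
    have minv: "(1 - cnj z0 * z) / (z - z0) = 1 / m" by (simp add: m_def blaschke_factor_def)
    have mod_m: "cmod ((z - z0) / (1 - cnj z0 * z)) = cmod m"
      by (simp add: m_def blaschke_factor_def)
    have "(cmod (f z - w))\<^sup>2 / (1 - (cmod w)\<^sup>2) = K * (cmod m)\<^sup>2 * (cmod (g z))\<^sup>2"
      unfolding fw K_def by (simp add: norm_mult power_mult_distrib)
    then have "R z = 1 / (1 - (cmod z)\<^sup>2) *
        (K * cmod m - K * (cmod m)\<^sup>2 * (cmod (g z))\<^sup>2 * cmod (1 / m))"
      unfolding R_def w_def[symmetric] minv mod_m K_def[symmetric] by (simp only:)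
    then show ?thesis using m0 by (simp add: norm_divide power2_eq_square field_simps)
  qed
  have Km: "K * cmod m > 0" using K0 m0 by simp
  have "L z \<le> R z" 
    unfolding L R using Schwarz_Pick(1)[OF g gle z] Km by (intro mult_left_mono) auto
  moreover have "L z = R z \<longleftrightarrow> blaschke_degree_le_2 f"
  proof
    assume "L z = R z"
    then have "cmod (deriv g z) = (1 - (cmod (g z))\<^sup>2) / (1 - (cmod z)\<^sup>2)"
      unfolding L R using Km by (simp only: mult_cancel_left) auto
    then obtain v q where v: "cmod v = 1" and q: "cmod q \<le> 1"
      and gv: "\<forall>x\<in>ball 0 1. g x = v * blaschke_factor q x"
      using Schwarz_Pick(2)[OF g gle z] by blast
    \<comment> \<open>Multiplying by \<open>b\<close> adds one factor, and \<open>f\<close> is recovered by the inverse automorphism.\<close>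
    have "blaschke_degree_le_2 (\<lambda>x. blaschke_factor w (f x))"
      unfolding blaschke_degree_le_2_def
      using v q z0 gv fg by (intro exI[of _ v] exI[of _ z0] exI[of _ q]) auto
    then have "blaschke_degree_le_2 (\<lambda>x. blaschke_factor (- w) (blaschke_factor w (f x)))"
      using w by (rule blaschke_degree_le_2_compose[where w = "- w", simplified])
    then show "blaschke_degree_le_2 f"
      unfolding blaschke_degree_le_2_def using blaschke_factor_inverse[OF w flt] by simp
  next
    assume "blaschke_degree_le_2 f"
    then obtain u a c where u: "cmod u = 1" and a: "cmod a \<le> 1" and c: "cmod c \<le> 1"
      and fb: "\<forall>x\<in>ball 0 1. f x = u * blaschke_factor a x * blaschke_factor c x"
      unfolding blaschke_degree_le_2_def by blast
    \<comment> \<open>Since \<open>f(z\<^sub>0) = w\<close>, the point \<open>z\<^sub>0\<close> is a root of the numerator of \<open>b\<^sub>w \<circ> f\<close>.\<close>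
    have "w = u * blaschke_factor a z0 * blaschke_factor c z0" using fb z0 by (simp add: w_def)
    then have "u * (z0 - a) * (z0 - c) = w * (1 - cnj a * z0) * (1 - cnj c * z0)"
      using blaschke_denominator_nonzero[OF a z0] blaschke_denominator_nonzero[OF c z0]
      by (simp add: blaschke_factor_def)
    from blaschke_factor_compose_at_zero[OF u a c w this]
    obtain v q where v: "cmod v = 1" and q: "cmod q \<le> 1"
      and vq: "\<And>x. cmod x < 1 \<Longrightarrow>
          blaschke_factor w (u * blaschke_factor a x * blaschke_factor c x)
            = v * blaschke_factor z0 x * blaschke_factor q x"
      by blast
    have "g x = v * blaschke_factor q x" if "x \<in> ball 0 1 - {z0}" for x
    proof -
      have x: "cmod x < 1" and "blaschke_factor z0 x \<noteq> 0"
        using that blaschke_denominator_nonzero[of z0 x] z0 by (auto simp: blaschke_factor_def)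
      then show ?thesis using fg[OF x] vq[OF x] fb by simp
    qed
    then have "eventually (\<lambda>x. g x = v * blaschke_factor q x) (nhds z)"
      by (intro eventually_mono[OF eventually_nhds_in_open[of "ball 0 1 - {z0}" z]])
         (use z ne in auto)
    then show "L z = R z" unfolding L R using Schwarz_Pick_equality[OF v q z] by simp
  qed
  ultimately show "L z \<le> R z \<and> (L z = R z \<longleftrightarrow> (\<exists>n\<le>2. blaschke_product n f))"
    by (simp add: blaschke_degree_le_2_iff)
qed

end
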